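(* Suppose the following. (i) For every $\theta\in\Theta$ the problem $\min_{t\in T}\, t+\mathrm{E}[l(\xi(\theta)-t)]$ has a unique optimal solution $t^*(\theta)$, and the compact interval $T$ is specified such that $t^*(\theta)$ is an interior point of $T$ for all $\theta\in\Theta$. (ii) For every $(\theta,t)\in\Theta\times T$, $l(\xi(\theta)-t)$ is continuously differentiable at $(\theta,t)$ with probability 1. There exists a random variable $L$ with $\mathrm{E}[L^2]<\infty$ such that $|l(\xi(\theta)-t)|\le L$ for all $(\theta,t)\in\Theta\times T$ and a.e. $\xi$. There exists a random variable $K$ with $\mathrm{E}[K^2]<\infty$ such that $$|l(\xi(\theta_1)-t_1)-l(\xi(\theta_2)-t_2)|\le K\,\|(\theta_1,t_1)-(\theta_2,t_2)\|$$ for all $(\theta_1,t_1),(\theta_2,t_2)\in\Theta\times T$ and a.e. $\xi$. Then for $\theta\in\Theta$, $$\frac{d\rho(\theta)}{d\theta}=\mathrm{E}\left[l'(\xi(\theta)-t^*(\theta))\,\xi'(\theta)\right].$$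
   Context: Let $u$ be a proper closed concave nondecreasing utility function with $u(0)=0$ and $1\in\partial u(0)$ (subdifferential), and let $l(z)=-u(-z)$ (so $l$ is proper, closed, convex and nondecreasing). Let $\Theta\subset\mathbb{R}$ be a compact set, and for $\theta\in\Theta$ let $\xi(\theta)$ be a real random loss depending on the one-dimensional parameter $\theta$; the sample path derivative $\xi'(\theta)$ is assumed to exist with probability 1. Let $T\subset\mathbb{R}$ be a compact interval. The OCE (optimized certainty equivalent) risk measure of $\xi(\theta)$ is $\rho(\theta)=\min_{t\in T}\left\{t+\mathrm{E}[l(\xi(\theta)-t)]\right\}$. *)

theory Defs
  imports "HOL-Probability.Probability"
begin

definition hypograph :: "('a \<Rightarrow> ereal) \<Rightarrow> ('a \<times> real) set" where
  "hypograph u = {(x, r). ereal r \<le> u x}"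

definition proper_concave_fun :: "('a::real_vector \<Rightarrow> ereal) \<Rightarrow> bool" where
  "proper_concave_fun u \<longleftrightarrow>
     convex (hypograph u) \<and> (\<exists>x. u x \<noteq> -\<infinity>) \<and> (\<forall>x. u x \<noteq> \<infinity>)"

definition closed_concave_fun :: "('a::topological_space \<Rightarrow> ereal) \<Rightarrow> bool" where
  "closed_concave_fun u \<longleftrightarrow> closed (hypograph u)"

text \<open>The subdifferential of a concave function is taken in the concave sense
  (affine majorants touching at the point).\<close>

definition concave_subdifferential :: "(real \<Rightarrow> ereal) \<Rightarrow> real \<Rightarrow> real set" where
  "concave_subdifferential u x = {g. \<forall>z. u z \<le> u x + ereal (g * (z - x))}"

definition utility_function :: "(real \<Rightarrow> ereal) \<Rightarrow> bool" where
  "utility_function u \<longleftrightarrow>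
     proper_concave_fun u \<and> closed_concave_fun u \<and> mono u \<and>
     u 0 = 0 \<and> 1 \<in> concave_subdifferential u 0"

definition loss_of_utility :: "(real \<Rightarrow> ereal) \<Rightarrow> real \<Rightarrow> ereal" where
  "loss_of_utility u z = - u (- z)"

text \<open>Expectation of an extended-real random variable as the difference of the expectations of
  its positive and negative parts (the map \<^const>\<open>e2ennreal\<close> sends negative values to
  \<open>0\<close>). In type \<^typ>\<open>ereal\<close>, \<open>\<infinity> - \<infinity> = \<infinity>\<close>, the usual convention for minimization.\<close>

definition ereal_expectation :: "'w measure \<Rightarrow> ('w \<Rightarrow> ereal) \<Rightarrow> ereal" where
  "ereal_expectation M X =
     enn2ereal (\<integral>\<^sup>+\<omega>. e2ennreal (X \<omega>) \<partial>M) - enn2ereal (\<integral>\<^sup>+\<omega>. e2ennreal (- X \<omega>) \<partial>M)"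

definition oce_objective :: "'w measure \<Rightarrow> (real \<Rightarrow> ereal) \<Rightarrow> ('w \<Rightarrow> real) \<Rightarrow> real \<Rightarrow> ereal" where
  "oce_objective M l X t = ereal t + ereal_expectation M (\<lambda>\<omega>. l (X \<omega> - t))"

definition oce_risk :: "'w measure \<Rightarrow> (real \<Rightarrow> ereal) \<Rightarrow> real set \<Rightarrow> ('w \<Rightarrow> real) \<Rightarrow> ereal" where
  "oce_risk M l T X = (INF t\<in>T. oce_objective M l X t)"

text \<open>Continuous differentiability at a point of an extended-real function: near \<open>x\<close> the
  function is finite and differentiable, and its derivative is continuous at \<open>x\<close>. The
  real-valued \<open>g\<close> enforces finiteness, which \<^const>\<open>real_of_ereal\<close> would not.\<close>

definition continuously_differentiable_at :: "('a::real_normed_vector \<Rightarrow> ereal) \<Rightarrow> 'a \<Rightarrow> bool" where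
  "continuously_differentiable_at f x \<longleftrightarrow>
     (\<exists>(g :: 'a \<Rightarrow> real) (g' :: 'a \<Rightarrow> 'a \<Rightarrow>\<^sub>L real).
        (\<forall>\<^sub>F y in nhds x. f y = ereal (g y) \<and> (g has_derivative blinfun_apply (g' y)) (at y)) \<and>
        isCont g' x)"

end

theory Submission
  imports Defs
begin

text \<open>
  This is an envelope theorem. Write \<open>\<phi> \<theta> t = t + E[l (\<xi> \<theta> - t)]\<close>, so that
  \<open>\<rho> \<theta> = \<phi> \<theta> (t* \<theta>)\<close>. If \<open>s\<close> is another parameter, using \<open>t* \<theta>\<close> at \<open>s\<close> bounds
  \<open>\<rho> s - \<rho> \<theta>\<close> from above by \<open>\<phi> s (t* \<theta>) - \<phi> \<theta> (t* \<theta>)\<close>, and using \<open>t* s\<close> at \<open>\<theta>\<close> bounds it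
  from below by \<open>\<phi> s (t* s) - \<phi> \<theta> (t* s)\<close>. In both bounds only the parameter varies, not the
  decision \<open>t\<close>. After division by \<open>s - \<theta>\<close> both converge to \<open>E[l' (\<xi> \<theta> - t* \<theta>) \<xi>' \<theta>]\<close> as
  \<open>s\<close> tends to \<open>\<theta>\<close> within \<open>\<Theta>\<close>, and the difference quotient of \<open>\<rho>\<close> is squeezed between them
  (\<open>envelope_derivative\<close>).

  Three facts give the two limits. First, \<open>t* s\<close> tends to \<open>t* \<theta>\<close>: as \<open>\<phi>\<close> is continuous (it
  inherits the Lipschitz bound \<open>K\<close>) and the minimizer is unique, the graph of \<open>t*\<close> is closed,
  and a function into a compact set with a closed graph is continuous
  (\<open>continuous_on_argmin\<close>). Second, for almost every outcome the quotients of \<open>l (\<xi> \<theta> - t)\<close> in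
  \<open>\<theta>\<close> converge even though \<open>t = t* s\<close> moves with \<open>s\<close>: a function that is
  continuously differentiable at a point is strictly differentiable there
  (\<open>loss_difference_quotient_tendsto\<close>). Third, \<open>K\<close> dominates all these quotients, so the
  limit passes through the expectation.

  Dominated convergence needs a measurable limit. Off a null set this is no issue, but \<open>M\<close>
  need not be complete, and at points where \<open>l\<close> is not differentiable \<open>deriv\<close> takes an
  arbitrary fixed value. The derivative of the loss is therefore shown to be Borel everywhere, which
  uses convexity of \<open>l\<close> (\<open>borel_measurable_deriv_loss\<close>).

  At an isolated point of \<open>\<Theta>\<close> no sequence in \<open>\<Theta> - {\<theta>}\<close> tends to \<open>\<theta>\<close>; the sequential form of
  the argument then proves the derivative claim vacuously.
\<close>

section \<open>Measurability of the derivative of a convex function\<close>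

text \<open>Slopes of a convex function increase in the increment. Hence two symmetric increments
  control all smaller ones, which turns convergence along one sequence into differentiability.\<close>

lemma convex_on_slope_between:
  fixes f :: "real \<Rightarrow> real"
  assumes f: "convex_on S f" and S: "z - d \<in> S" "z + d \<in> S" and h: "h \<noteq> 0" "\<bar>h\<bar> < d"
  shows "(f (z - d) - f z) / - d \<le> (f (z + h) - f z) / h"
    and "(f (z + h) - f z) / h \<le> (f (z + d) - f z) / d"
proof -
  have "is_interval S"
    using convex_on_imp_convex[OF f] by (simp add: is_interval_convex_1)
  then have between: "w \<in> S" if "z - d \<le> w" "w \<le> z + d" for w
    using S that unfolding is_interval_1 by blast
  have "z \<in> S" "z + h \<in> S"
    using h by (auto intro!: between)
  then have *: "(f (z - d) - f z) / - d \<le> (f (z + h) - f z) / h \<and>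
      (f (z + h) - f z) / h \<le> (f (z + d) - f z) / d"
  proof (cases "h > 0")
    case True
    then have a: "z < z + h" "z + h < z + d" "z - d < z" "z < z + d" "z - d < z + h"
      using h by auto
    have "(f z - f (z + h)) / (z - (z + h)) \<le> (f z - f (z + d)) / (z - (z + d))"
      by (rule convex_on_slope_le(1)[OF f \<open>z \<in> S\<close> S(2) a(1,2)])
    moreover have "(f (z - d) - f z) / (z - d - z) \<le> (f (z - d) - f (z + h)) / (z - d - (z + h))"
      by (rule convex_on_slope_le(1)[OF f S(1) \<open>z + h \<in> S\<close> a(3,1)])
    moreover have "\<dots> \<le> (f z - f (z + h)) / (z - (z + h))"
      by (rule convex_on_slope_le(2)[OF f S(1) \<open>z + h \<in> S\<close> a(3,1)])
    moreover have "(f z - f (z + h)) / (z - (z + h)) = (f (z + h) - f z) / h"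
      "(f z - f (z + d)) / (z - (z + d)) = (f (z + d) - f z) / d"
      "(f (z - d) - f z) / (z - d - z) = (f (z - d) - f z) / - d"
      using True a by (auto simp: field_simps)
    ultimately show ?thesis by linarith
  next
    case False
    then have a: "z - d < z + h" "z + h < z" "z < z + d"
      using h by auto
    have "(f (z + h) - f z) / (z + h - z) \<le> (f (z + h) - f (z + d)) / (z + h - (z + d))"
      by (rule convex_on_slope_le(1)[OF f \<open>z + h \<in> S\<close> S(2) a(2,3)])
    moreover have "\<dots> \<le> (f z - f (z + d)) / (z - (z + d))"
      by (rule convex_on_slope_le(2)[OF f \<open>z + h \<in> S\<close> S(2) a(2,3)])
    moreover have "(f (z - d) - f z) / (z - d - z) \<le> (f (z + h) - f z) / (z + h - z)"
      by (rule convex_on_slope_le(2)[OF f S(1) \<open>z \<in> S\<close> a(1,2)])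
    moreover have "(f z - f (z + d)) / (z - (z + d)) = (f (z + d) - f z) / d"
      using a by (auto simp: field_simps)
    ultimately show ?thesis by simp
  qed
  then show "(f (z - d) - f z) / - d \<le> (f (z + h) - f z) / h"
    and "(f (z + h) - f z) / h \<le> (f (z + d) - f z) / d" by auto
qed

text \<open>For a convex function, differentiability at a point can be read off from countably many
  difference quotients; this is what makes the set of differentiability points Borel.\<close>

lemma DERIV_convex_iff_sequential:
  fixes f :: "real \<Rightarrow> real"
  assumes f: "convex_on S f" and S: "open S" "z \<in> S"
  defines "d \<equiv> \<lambda>n. inverse (real (Suc n))"
  shows "DERIV f z :> D \<longleftrightarrow>
    (\<lambda>n. (f (z + d n) - f z) / d n) \<longlonglongrightarrow> D \<and> (\<lambda>n. (f (z - d n) - f z) / - d n) \<longlonglongrightarrow> D"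
proof
  have d0: "d \<longlonglongrightarrow> 0" "\<And>n. d n \<noteq> 0" "\<And>n. d n > 0"
    unfolding d_def using LIMSEQ_inverse_real_of_nat by auto
  then have r: "filterlim d (at 0) sequentially" "filterlim (\<lambda>n. - d n) (at 0) sequentially"
    using tendsto_minus[OF d0(1)] by (auto simp: filterlim_at)
  {
    assume "DERIV f z :> D"
    then have "((\<lambda>h. (f (z + h) - f z) / h) \<longlongrightarrow> D) (at 0)"
      by (simp add: DERIV_def)
    from filterlim_compose[OF this r(1)] filterlim_compose[OF this r(2)]
    show "(\<lambda>n. (f (z + d n) - f z) / d n) \<longlonglongrightarrow> D \<and> (\<lambda>n. (f (z - d n) - f z) / - d n) \<longlonglongrightarrow> D"
      by simp
  }
  assume L: "(\<lambda>n. (f (z + d n) - f z) / d n) \<longlonglongrightarrow> D \<and> (\<lambda>n. (f (z - d n) - f z) / - d n) \<longlonglongrightarrow> D"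
  show "DERIV f z :> D"
    unfolding DERIV_def
  proof (rule tendstoI)
    fix e :: real assume "e > 0"
    have "(\<lambda>n. z + d n) \<longlonglongrightarrow> z" "(\<lambda>n. z - d n) \<longlonglongrightarrow> z"
      using tendsto_add[OF tendsto_const d0(1), of z] tendsto_diff[OF tendsto_const d0(1), of z]
      by auto
    then have "\<forall>\<^sub>F n in sequentially. z + d n \<in> S" "\<forall>\<^sub>F n in sequentially. z - d n \<in> S"
      using topological_tendstoD S by blast+
    moreover have "\<forall>\<^sub>F n in sequentially. dist ((f (z + d n) - f z) / d n) D < e"
      "\<forall>\<^sub>F n in sequentially. dist ((f (z - d n) - f z) / - d n) D < e"
      using L \<open>e > 0\<close> tendstoD by blast+
    ultimately have "\<forall>\<^sub>F n in sequentially. z + d n \<in> S \<and> z - d n \<in> S \<and>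
        dist ((f (z + d n) - f z) / d n) D < e \<and> dist ((f (z - d n) - f z) / - d n) D < e"
      by (intro eventually_conj)
    then obtain n where n: "z + d n \<in> S" "z - d n \<in> S"
        "dist ((f (z + d n) - f z) / d n) D < e" "dist ((f (z - d n) - f z) / - d n) D < e"
      using eventually_happens'[OF sequentially_bot] by blast
    show "\<forall>\<^sub>F h in at 0. dist ((f (z + h) - f z) / h) D < e"
      unfolding eventually_at
    proof (intro exI[of _ "d n"] conjI ballI impI)
      fix h :: real assume "h \<noteq> 0 \<and> dist h 0 < d n"
      then show "dist ((f (z + h) - f z) / h) D < e"
        using convex_on_slope_between[OF f n(2,1), of h] n(3,4)
        unfolding dist_real_def by auto
    qed (use d0 in auto)
  qed
qed

lemma borel_measurable_deriv_convex:
  fixes f :: "real \<Rightarrow> real"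
  assumes f: "convex_on S f" and S: "open S" and m[measurable]: "f \<in> borel_measurable borel"
  shows "deriv f \<in> borel_measurable (restrict_space borel S)"
proof -
  define d where "d n = inverse (real (Suc n))" for n
  define r where "r n z = (f (z + d n) - f z) / d n" for n z
  define l where "l n z = (f (z - d n) - f z) / - d n" for n z
  have [measurable]: "r n \<in> borel_measurable borel" "l n \<in> borel_measurable borel" for n
    unfolding r_def l_def by measurable
  define P where "P z \<longleftrightarrow> Cauchy (\<lambda>n. r n z) \<and> Cauchy (\<lambda>n. l n z) \<and>
    lim (\<lambda>n. r n z) = lim (\<lambda>n. l n z)" for z
  have [measurable]: "Measurable.pred borel P"
    unfolding P_def pred_def by measurable
  \<comment> \<open>Where no derivative exists, \<open>deriv\<close> unfolds to a choice from the empty predicate, the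
    same value at all such points.\<close>
  have eq: "deriv f z = (if P z then lim (\<lambda>n. r n z) else (SOME D. False))" if z: "z \<in> S" for z
  proof -
    have D: "DERIV f z :> D \<longleftrightarrow> (\<lambda>n. r n z) \<longlonglongrightarrow> D \<and> (\<lambda>n. l n z) \<longlonglongrightarrow> D" for D
      unfolding r_def l_def d_def by (rule DERIV_convex_iff_sequential[OF f S z])
    show ?thesis
    proof (cases "P z")
      case True
      then have "DERIV f z :> lim (\<lambda>n. r n z)"
        unfolding D P_def Cauchy_convergent_iff convergent_LIMSEQ_iff by metis
      with True show ?thesis by (simp add: DERIV_imp_deriv)
    next
      case False
      then have "\<not> (DERIV f z :> D)" for D
        unfolding D P_def Cauchy_convergent_iff by (metis convergent_def limI)
      with False show ?thesis by (simp add: deriv_def)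
    qed
  qed
  have "(\<lambda>z. if P z then lim (\<lambda>n. r n z) else (SOME D. False)) \<in> borel_measurable borel"
    by measurable
  then show ?thesis
    by (subst measurable_cong[OF eq]) (auto simp: space_restrict_space intro: measurable_restrict_space1)
qed

section \<open>The loss function of a utility\<close>

text \<open>The superlevel sets of a monotone function are intervals.\<close>

lemma borel_measurable_mono_ereal:
  fixes l :: "real \<Rightarrow> ereal"
  assumes "mono l"
  shows "l \<in> borel_measurable borel"
proof (rule borel_measurableI_greater)
  fix y
  have "is_interval {x. y < l x}"
    unfolding is_interval_1 using monoD[OF assms] order.strict_trans2 by blast
  then show "{x \<in> space borel. y < l x} \<in> sets borel"
    by (simp add: real_interval_borel_measurable)
qed

lemma loss_of_utility_mono:
  assumes "utility_function u"
  shows "mono (loss_of_utility u)"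
  using assms unfolding utility_function_def loss_of_utility_def mono_def by auto

lemma borel_measurable_loss:
  assumes "utility_function u"
  shows "loss_of_utility u \<in> borel_measurable borel"
  by (intro borel_measurable_mono_ereal loss_of_utility_mono assms)

lemma loss_of_utility_0:
  assumes "utility_function u"
  shows "loss_of_utility u 0 = 0"
  using assms by (simp add: utility_function_def loss_of_utility_def)

lemma loss_of_utility_not_MInf:
  assumes "utility_function u"
  shows "loss_of_utility u z \<noteq> -\<infinity>"
  using assms by (auto simp: utility_function_def loss_of_utility_def proper_concave_fun_def)

lemma convex_on_loss:
  assumes u: "utility_function u" and S: "convex S" "\<And>z. z \<in> S \<Longrightarrow> loss_of_utility u z \<noteq> \<infinity>"
  shows "convex_on S (\<lambda>z. real_of_ereal (loss_of_utility u z))"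
  unfolding convex_on_def
proof (intro conjI S ballI allI impI)
  fix x y a b :: real
  assume xy: "x \<in> S" "y \<in> S" and ab: "0 \<le> a" "0 \<le> b" "a + b = 1"
  define f where "f z = real_of_ereal (loss_of_utility u z)" for z
  have f: "u (- z) = ereal (- f z)" if "z \<in> S" for z
    using S(2)[OF that] loss_of_utility_not_MInf[OF u, of z]
    unfolding f_def loss_of_utility_def by (cases "u (- z)") auto
  have "convex (hypograph u)"
    using u by (simp add: utility_function_def proper_concave_fun_def)
  moreover have "(- x, - f x) \<in> hypograph u" "(- y, - f y) \<in> hypograph u"
    using f xy by (auto simp: hypograph_def)
  ultimately have "a *\<^sub>R (- x, - f x) + b *\<^sub>R (- y, - f y) \<in> hypograph u"
    using ab by (intro convexD)
  then have "ereal (- (a * f x + b * f y)) \<le> u (- (a *\<^sub>R x + b *\<^sub>R y))"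
    by (simp add: hypograph_def algebra_simps)
  also have "u (- (a *\<^sub>R x + b *\<^sub>R y)) = ereal (- f (a *\<^sub>R x + b *\<^sub>R y))"
    using S(1) xy ab by (intro f convexD)
  finally show "f (a *\<^sub>R x + b *\<^sub>R y) \<le> a * f x + b * f y"
    by simp
qed

text \<open>By monotonicity the loss is finite exactly on a downward closed set of reals. If this is
  not the whole line, it has an endpoint \<open>b\<close>. To the left of \<open>b\<close> the loss is convex, to the right the real-valued version
  is constantly \<open>real_of_ereal \<infinity> = 0\<close>, and the single point \<open>b\<close> cannot destroy measurability.\<close>

lemma borel_measurable_deriv_loss:
  assumes u: "utility_function u"
  shows "deriv (\<lambda>z. real_of_ereal (loss_of_utility u z)) \<in> borel_measurable borel"
    (is "deriv ?f \<in> _")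
proof -
  let ?l = "loss_of_utility u"
  have down: "?l x \<noteq> \<infinity>" if "x \<le> y" "?l y \<noteq> \<infinity>" for x y
    using monoD[OF loss_of_utility_mono[OF u] that(1)] that(2) by auto
  have m: "?f \<in> borel_measurable borel"
    using borel_measurable_loss[OF u] by measurable
  show ?thesis
  proof (cases "\<forall>z. ?l z \<noteq> \<infinity>")
    case True
    then show ?thesis
      using borel_measurable_deriv_convex[OF convex_on_loss[OF u, of UNIV] open_UNIV m] by simp
  next
    case False
    then obtain c where c: "?l c = \<infinity>" by auto
    define b where "b = Sup {z. ?l z \<noteq> \<infinity>}"
    have bdd: "bdd_above {z. ?l z \<noteq> \<infinity>}"
      using down c by (intro bdd_aboveI[of _ c]) (metis linear mem_Collect_eq)
    have ne: "{z. ?l z \<noteq> \<infinity>} \<noteq> {}"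
      using loss_of_utility_0[OF u] by (auto intro!: exI[of _ 0])
    have below: "?l z \<noteq> \<infinity>" if "z < b" for z
      using that less_cSup_iff[OF ne bdd] down[OF less_imp_le] unfolding b_def by blast
    have above: "?l z = \<infinity>" if "b < z" for z
      using that cSup_upper[OF _ bdd, of z] unfolding b_def by auto
    have "deriv ?f z = 0" if "b < z" for z
    proof (rule DERIV_imp_deriv)
      have "\<forall>\<^sub>F x in nhds z. ?f x = 0"
        using eventually_nhds_in_open[of "{b<..}" z] that by (auto elim!: eventually_mono simp: above)
      then show "DERIV ?f z :> 0"
        by (subst DERIV_cong_ev[OF refl _ refl]) auto
    qed
    then have eq: "(if z \<in> {..<b} then deriv ?f z else 0) = deriv ?f z" if "z \<noteq> b" for z
      using that by auto
    have "deriv ?f \<in> borel_measurable (restrict_space borel {..<b})"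
      using below by (intro borel_measurable_deriv_convex convex_on_loss[OF u] m) auto
    then have "(\<lambda>z. if z \<in> {..<b} then deriv ?f z else 0) \<in> borel_measurable borel"
      by (subst (asm) measurable_restrict_space_iff) auto
    then show ?thesis
      by (rule measurable_discrete_difference[where X = "{b}"]) (use eq in auto)
  qed
qed

section \<open>Difference quotients with a moving base point\<close>

text \<open>Strict differentiability: in the defining estimate of the derivative at \<open>p\<close> both
  arguments may vary near \<open>p\<close>. It follows from the mean value inequality on a small ball around
  \<open>p\<close>, on which the derivative is close to its value at \<open>p\<close>.\<close>

lemma continuously_differentiable_at_imp_strict:
  fixes F :: "'a::real_normed_vector \<Rightarrow> ereal"
  assumes "continuously_differentiable_at F p"
  obtains D where "((\<lambda>y. real_of_ereal (F y)) has_derivative D) (at p)"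
    and "\<And>e. e > 0 \<Longrightarrow> \<exists>r>0. \<forall>x\<in>ball p r. \<forall>y\<in>ball p r.
      \<bar>real_of_ereal (F y) - real_of_ereal (F x) - D (y - x)\<bar> \<le> e * norm (y - x)"
proof -
  obtain g g' where ev: "\<forall>\<^sub>F y in nhds p. F y = ereal (g y) \<and> (g has_derivative blinfun_apply (g' y)) (at y)"
    and cont: "isCont g' p"
    using assms unfolding continuously_differentiable_at_def by auto
  show thesis
  proof (rule that[of "blinfun_apply (g' p)"])
    have "\<forall>\<^sub>F y in nhds p. g y = real_of_ereal (F y)"
      using ev by (auto elim!: eventually_mono)
    moreover have "(g has_derivative blinfun_apply (g' p)) (at p)"
      using eventually_nhds_x_imp_x[OF ev] by simp
    ultimately show "((\<lambda>y. real_of_ereal (F y)) has_derivative blinfun_apply (g' p)) (at p)"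
      using eventually_nhds_x_imp_x[OF \<open>\<forall>\<^sub>F y in nhds p. g y = real_of_ereal (F y)\<close>]
      by (elim has_derivative_transform_eventually)
        (auto simp: eventually_at_filter elim: eventually_mono)
  next
    fix e :: real assume "e > 0"
    then have "\<forall>\<^sub>F y in nhds p. dist (g' y) (g' p) < e"
      using cont tendstoD unfolding isCont_def tendsto_at_iff_tendsto_nhds by blast
    from eventually_conj[OF ev this] obtain r where r: "r > 0"
      "\<And>y. dist y p < r \<Longrightarrow> F y = ereal (g y) \<and> (g has_derivative blinfun_apply (g' y)) (at y)
         \<and> dist (g' y) (g' p) < e"
      unfolding eventually_nhds_metric by auto
    show "\<exists>r>0. \<forall>x\<in>ball p r. \<forall>y\<in>ball p r.
      \<bar>real_of_ereal (F y) - real_of_ereal (F x) - blinfun_apply (g' p) (y - x)\<bar> \<le> e * norm (y - x)"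
    proof (intro exI[of _ r] conjI ballI r)
      fix x y assume xy: "x \<in> ball p r" "y \<in> ball p r"
      have "norm (g y - g x - blinfun_apply (g' p) (y - x)) \<le> norm (y - x) * e"
      proof (rule differentiable_bound_linearization[of x y "ball p r" g "\<lambda>w. blinfun_apply (g' w)" p e])
        show "x + t *\<^sub>R (y - x) \<in> ball p r" if "t \<in> {0..1}" for t
          using convexD_alt[OF convex_ball[of p r] xy, of t] that by (simp add: algebra_simps)
        show "(g has_derivative blinfun_apply (g' w)) (at w within ball p r)" if "w \<in> ball p r" for w
          using r(2)[of w] that by (auto simp: dist_commute intro: has_derivative_at_withinI)
        show "onorm (blinfun_apply (g' w) - blinfun_apply (g' p)) \<le> e" if "w \<in> ball p r" for w
        proof -
          have "norm (g' w - g' p) < e"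
            using r(2)[of w] that by (simp add: dist_commute dist_norm[symmetric])
          then show ?thesis
            by (simp add: norm_blinfun.rep_eq minus_blinfun.rep_eq fun_diff_def)
        qed
      qed (use r in auto)
      then show "\<bar>real_of_ereal (F y) - real_of_ereal (F x) - blinfun_apply (g' p) (y - x)\<bar> \<le> e * norm (y - x)"
        using r(2)[of x] r(2)[of y] xy by (simp add: dist_commute mult.commute)
    qed
  qed
qed

text \<open>The quotient is taken in the parameter at the decision \<open>\<tau> n\<close>, which itself moves; strict
  differentiability in the pair absorbs this. The hypothesis speaks of
  \<open>l (X \<theta> - t)\<close> jointly in both variables, not of \<open>l\<close>: differentiability of \<open>l\<close> itself
  is recovered from the direction \<open>t\<close>, in which \<open>X \<theta> - t\<close> runs through a
  neighbourhood, and the limit is then identified by the chain rule.\<close>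

lemma loss_difference_quotient_tendsto:
  fixes l :: "real \<Rightarrow> ereal" and X :: "real \<Rightarrow> real"
  assumes C: "continuously_differentiable_at (\<lambda>(\<theta>, t). l (X \<theta> - t)) (\<theta>, t)"
    and X: "(X has_real_derivative X') (at \<theta>)"
    and s: "s \<longlonglongrightarrow> \<theta>" "\<And>n. s n \<noteq> \<theta>" and \<tau>: "\<tau> \<longlonglongrightarrow> t"
  defines "f \<equiv> \<lambda>z. real_of_ereal (l z)"
  shows "(\<lambda>n. (f (X (s n) - \<tau> n) - f (X \<theta> - \<tau> n)) / (s n - \<theta>)) \<longlonglongrightarrow> deriv f (X \<theta> - t) * X'"
proof -
  define F where "F p = f (X (fst p) - snd p)" for p
  have "continuously_differentiable_at (\<lambda>p. l (X (fst p) - snd p)) (\<theta>, t)"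
    using C by (simp add: case_prod_unfold)
  then obtain D where D: "(F has_derivative D) (at (\<theta>, t))"
    and strict: "\<And>e. e > 0 \<Longrightarrow> \<exists>r>0. \<forall>x\<in>ball (\<theta>, t) r. \<forall>y\<in>ball (\<theta>, t) r.
      \<bar>F y - F x - D (y - x)\<bar> \<le> e * norm (y - x)"
    unfolding F_def f_def by (rule continuously_differentiable_at_imp_strict) blast
  \<comment> \<open>Near \<open>X \<theta> - t\<close> the loss is \<open>F\<close> along \<open>w \<mapsto> (\<theta>, X \<theta> - w)\<close>.\<close>
  have "(f has_derivative (\<lambda>h. D (0, - h))) (at (X \<theta> - t))"
  proof -
    have "((\<lambda>w. (\<theta>, X \<theta> - w)) has_derivative (\<lambda>h. (0, - h))) (at (X \<theta> - t))"
      by (auto intro!: derivative_eq_intros)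
    from has_derivative_compose[OF this, of F D] D
    show ?thesis by (simp add: F_def)
  qed
  then have "f differentiable at (X \<theta> - t)" by (rule differentiableI)
  then have f: "DERIV f (X \<theta> - t) :> deriv f (X \<theta> - t)"
    using DERIV_deriv_iff_real_differentiable by blast
  have "((\<lambda>s. f (X s - t)) has_real_derivative deriv f (X \<theta> - t) * X') (at \<theta>)"
    using DERIV_chain2[of f "deriv f (X \<theta> - t)" "\<lambda>s. X s - t" \<theta> X' UNIV] f DERIV_diff[OF X DERIV_const]
    by simp
  moreover have "((\<lambda>s. f (X s - t)) has_derivative (\<lambda>h. D (h, 0))) (at \<theta>)"
  proof -
    have "((\<lambda>s. (s, t)) has_derivative (\<lambda>h. (h, 0))) (at \<theta>)"
      by (auto intro!: derivative_eq_intros)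
    from has_derivative_compose[OF this, of F D] D
    show ?thesis by (simp add: F_def)
  qed
  ultimately have "(\<lambda>h. D (h, 0)) = (*) (deriv f (X \<theta> - t) * X')"
    using has_derivative_unique unfolding has_field_derivative_def by blast
  then have D1: "D (h, 0) = deriv f (X \<theta> - t) * X' * h" for h
    by metis
  show ?thesis
  proof (rule tendstoI)
    fix e :: real assume "e > 0"
    then obtain r where r: "r > 0" and b: "\<And>x y. x \<in> ball (\<theta>, t) r \<Longrightarrow> y \<in> ball (\<theta>, t) r \<Longrightarrow>
      \<bar>F y - F x - D (y - x)\<bar>
        \<le> e / 2 * norm (y - x)"
      using strict[of "e / 2"] by (meson half_gt_zero)
    have "(\<lambda>n. (s n, \<tau> n)) \<longlonglongrightarrow> (\<theta>, t)" "(\<lambda>n. (\<theta>, \<tau> n)) \<longlonglongrightarrow> (\<theta>, t)"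
      by (intro tendsto_intros s \<tau>)+
    then have "\<forall>\<^sub>F n in sequentially. dist (s n, \<tau> n) (\<theta>, t) < r"
      "\<forall>\<^sub>F n in sequentially. dist (\<theta>, \<tau> n) (\<theta>, t) < r"
      using r tendstoD by blast+
    then show "\<forall>\<^sub>F n in sequentially. dist ((f (X (s n) - \<tau> n) - f (X \<theta> - \<tau> n)) / (s n - \<theta>))
      (deriv f (X \<theta> - t) * X') < e"
    proof eventually_elim
      case (elim n)
      let ?q = "f (X (s n) - \<tau> n) - f (X \<theta> - \<tau> n)" and ?h = "s n - \<theta>"
      have "\<bar>?q - D (?h, 0)\<bar> \<le> e / 2 * \<bar>?h\<bar>"
        using b[of "(\<theta>, \<tau> n)" "(s n, \<tau> n)"] elim by (simp add: dist_commute norm_Pair F_def)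
      moreover have "?h \<noteq> 0" using s(2) by simp
      moreover from this have "?q / ?h - deriv f (X \<theta> - t) * X' = (?q - D (?h, 0)) / ?h"
        unfolding D1 by (simp add: field_simps)
      ultimately have "\<bar>?q / ?h - deriv f (X \<theta> - t) * X'\<bar> \<le> e / 2"
        by (simp only: abs_divide) (simp add: divide_le_eq)
      then show ?case
        using \<open>e > 0\<close> by (simp add: dist_real_def)
    qed
  qed
qed

section \<open>Expectations of almost surely finite variables\<close>

lemma ereal_expectation_eq_integral:
  assumes "AE \<omega> in M. X \<omega> = ereal (Y \<omega>)" and Y: "integrable M Y"
  shows "ereal_expectation M X = ereal (\<integral>\<omega>. Y \<omega> \<partial>M)"
proof -
  have "(\<integral>\<^sup>+\<omega>. e2ennreal (X \<omega>) \<partial>M) = (\<integral>\<^sup>+\<omega>. ennreal (Y \<omega>) \<partial>M)"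
    "(\<integral>\<^sup>+\<omega>. e2ennreal (- X \<omega>) \<partial>M) = (\<integral>\<^sup>+\<omega>. ennreal (- Y \<omega>) \<partial>M)"
    using assms(1) by (auto intro!: nn_integral_cong_AE elim!: eventually_mono)
  moreover have "(\<integral>\<^sup>+\<omega>. ennreal (Y \<omega>) \<partial>M) < \<infinity>" "(\<integral>\<^sup>+\<omega>. ennreal (- Y \<omega>) \<partial>M) < \<infinity>"
    using integrableD[OF Y] by (auto simp: less_top)
  ultimately show ?thesis
    unfolding ereal_expectation_def real_lebesgue_integral_def[OF Y]
    by (cases "(\<integral>\<^sup>+\<omega>. ennreal (Y \<omega>) \<partial>M)"; cases "(\<integral>\<^sup>+\<omega>. ennreal (- Y \<omega>) \<partial>M)") (auto simp: enn2ereal_ennreal)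
qed

section \<open>The envelope theorem\<close>

text \<open>The graph of \<open>m\<close> consists of the pairs \<open>(\<theta>, t)\<close> with \<open>\<phi> \<theta> t \<le> \<phi> \<theta> r\<close> for all \<open>r\<close>; here
  uniqueness of the minimizer enters. It is an intersection of closed sets, and a closed graph over
  a compact codomain gives continuity.\<close>

lemma continuous_on_argmin:
  fixes \<phi> :: "'a::euclidean_space \<Rightarrow> 'b::euclidean_space \<Rightarrow> real"
  assumes "compact \<Theta>" "compact T" and cont: "continuous_on (\<Theta> \<times> T) (\<lambda>(\<theta>, t). \<phi> \<theta> t)"
    and mT: "\<And>\<theta>. \<theta> \<in> \<Theta> \<Longrightarrow> m \<theta> \<in> T"
    and min: "\<And>\<theta> t. \<theta> \<in> \<Theta> \<Longrightarrow> t \<in> T \<Longrightarrow> \<phi> \<theta> (m \<theta>) \<le> \<phi> \<theta> t"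
    and unique: "\<And>\<theta> t. \<theta> \<in> \<Theta> \<Longrightarrow> t \<in> T \<Longrightarrow> \<phi> \<theta> t \<le> \<phi> \<theta> (m \<theta>) \<Longrightarrow> t = m \<theta>"
  shows "continuous_on \<Theta> m"
proof (rule continuous_from_closed_graph[OF \<open>compact T\<close>])
  show "m \<in> \<Theta> \<rightarrow> T" using mT by auto
  have c: "closed {p \<in> \<Theta> \<times> T. \<phi> (fst p) (snd p) \<le> \<phi> (fst p) r}" if "r \<in> T" for r
  proof (rule continuous_on_closed_Collect_le)
    show "continuous_on (\<Theta> \<times> T) (\<lambda>p. \<phi> (fst p) (snd p))"
      using cont by (simp add: case_prod_unfold)
    show "continuous_on (\<Theta> \<times> T) (\<lambda>p. \<phi> (fst p) r)"
      by (rule continuous_on_compose2[OF cont, of _ "\<lambda>p. (fst p, r)", simplified])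
         (use that in \<open>auto intro!: continuous_intros\<close>)
    show "closed (\<Theta> \<times> T)"
      using assms(1,2) by (intro closed_Times compact_imp_closed)
  qed
  have "(\<lambda>\<theta>. (\<theta>, m \<theta>)) ` \<Theta> = (\<Theta> \<times> T) \<inter> (\<Inter>r\<in>T. {p \<in> \<Theta> \<times> T. \<phi> (fst p) (snd p) \<le> \<phi> (fst p) r})"
    using mT min unique by (fastforce simp: image_iff)
  also have "closed \<dots>"
    using c assms(1,2) by (intro closed_Int closed_INT closed_Times ballI) (auto intro: compact_imp_closed)
  finally show "closed ((\<lambda>\<theta>. (\<theta>, m \<theta>)) ` \<Theta>)" .
qed

text \<open>Comparing with the minimizer of the respective other parameter
  squeezes the difference quotient of the value function between partial quotients at \<open>m (s n)\<close>
  and at \<open>m \<theta>\<close>; which of the two is the lower bound depends on the sign of \<open>s n - \<theta>\<close>.\<close>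

lemma envelope_derivative:
  fixes \<phi> :: "real \<Rightarrow> 'b::topological_space \<Rightarrow> real"
  assumes m: "continuous_on \<Theta> m" and \<theta>: "\<theta> \<in> \<Theta>"
    and mT: "\<And>\<theta>. \<theta> \<in> \<Theta> \<Longrightarrow> m \<theta> \<in> T"
    and min: "\<And>\<theta> t. \<theta> \<in> \<Theta> \<Longrightarrow> t \<in> T \<Longrightarrow> \<phi> \<theta> (m \<theta>) \<le> \<phi> \<theta> t"
    and quot: "\<And>s \<tau>. (\<And>n. s n \<in> \<Theta> - {\<theta>}) \<Longrightarrow> (\<And>n. \<tau> n \<in> T) \<Longrightarrow> s \<longlonglongrightarrow> \<theta> \<Longrightarrow> \<tau> \<longlonglongrightarrow> m \<theta> \<Longrightarrow>
      (\<lambda>n. (\<phi> (s n) (\<tau> n) - \<phi> \<theta> (\<tau> n)) / (s n - \<theta>)) \<longlonglongrightarrow> D"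
  shows "((\<lambda>\<theta>. \<phi> \<theta> (m \<theta>)) has_real_derivative D) (at \<theta> within \<Theta>)"
  unfolding has_field_derivative_iff tendsto_at_iff_sequentially
proof (intro allI impI)
  fix s assume s: "\<forall>n. s n \<in> \<Theta> - {\<theta>}" "s \<longlonglongrightarrow> \<theta>"
  define A where "A n = (\<phi> (s n) (m (s n)) - \<phi> \<theta> (m (s n))) / (s n - \<theta>)" for n
  define B where "B n = (\<phi> (s n) (m \<theta>) - \<phi> \<theta> (m \<theta>)) / (s n - \<theta>)" for n
  define Q where "Q n = (\<phi> (s n) (m (s n)) - \<phi> \<theta> (m \<theta>)) / (s n - \<theta>)" for n
  have "(\<lambda>n. m (s n)) \<longlonglongrightarrow> m \<theta>"
    using continuous_on_tendsto_compose[OF m s(2) \<theta>] s(1) by auto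
  then have A: "A \<longlonglongrightarrow> D" and B: "B \<longlonglongrightarrow> D"
    unfolding A_def B_def using s mT \<theta> by (auto intro!: quot)
  have Q: "min (A n) (B n) \<le> Q n \<and> Q n \<le> max (A n) (B n)" for n
  proof -
    have n: "s n \<in> \<Theta>" "s n \<noteq> \<theta>" using s by auto
    have le: "\<phi> (s n) (m (s n)) - \<phi> \<theta> (m (s n)) \<le> \<phi> (s n) (m (s n)) - \<phi> \<theta> (m \<theta>)"
      "\<phi> (s n) (m (s n)) - \<phi> \<theta> (m \<theta>) \<le> \<phi> (s n) (m \<theta>) - \<phi> \<theta> (m \<theta>)"
      using min[OF \<theta> mT[OF n(1)]] min[OF n(1) mT[OF \<theta>]] by auto
    show ?thesis
    proof (cases "s n - \<theta> > 0")
      case True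
      then show ?thesis
        using divide_right_mono[OF le(1), of "s n - \<theta>"] divide_right_mono[OF le(2), of "s n - \<theta>"]
        unfolding A_def B_def Q_def by (simp add: min_le_iff_disj le_max_iff_disj)
    next
      case False
      then show ?thesis
        using divide_right_mono_neg[OF le(1), of "s n - \<theta>"] divide_right_mono_neg[OF le(2), of "s n - \<theta>"]
        unfolding A_def B_def Q_def by (simp add: min_le_iff_disj le_max_iff_disj)
    qed
  qed
  have "Q \<longlonglongrightarrow> D"
    by (rule tendsto_sandwich[of "\<lambda>n. min (A n) (B n)" _ _ "\<lambda>n. max (A n) (B n)"])
       (use Q tendsto_min[OF A B] tendsto_max[OF A B] in auto)
  then show "((\<lambda>y. (\<phi> y (m y) - \<phi> \<theta> (m \<theta>)) / (y - \<theta>)) \<circ> s) \<longlonglongrightarrow> D"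
    by (simp add: Q_def[abs_def] comp_def)
qed

section \<open>Differentiating the risk measure\<close>

theorem proposition5:
  fixes M :: "'w measure"
    and u l :: "real \<Rightarrow> ereal"
    and \<xi> \<xi>' :: "real \<Rightarrow> 'w \<Rightarrow> real"
    and \<Theta> T :: "real set"
    and tstar :: "real \<Rightarrow> real"
  assumes "prob_space M"
    and "utility_function u"
    and "l = loss_of_utility u"
    and "compact \<Theta>"
    and "compact T" and "is_interval T"
    and "\<forall>\<theta>\<in>\<Theta>. \<xi> \<theta> \<in> borel_measurable M"
    and "\<forall>\<theta>\<in>\<Theta>. \<xi>' \<theta> \<in> borel_measurable M"
    and "\<forall>\<theta>\<in>\<Theta>. AE \<omega> in M. ((\<lambda>\<theta>. \<xi> \<theta> \<omega>) has_real_derivative \<xi>' \<theta> \<omega>) (at \<theta>)"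
    and "\<forall>\<theta>\<in>\<Theta>. \<forall>t. is_arg_min (oce_objective M l (\<xi> \<theta>)) (\<lambda>t. t \<in> T) t \<longleftrightarrow> t = tstar \<theta>"
    and "\<forall>\<theta>\<in>\<Theta>. tstar \<theta> \<in> interior T"
    and "\<forall>\<theta>\<in>\<Theta>. \<forall>t\<in>T. AE \<omega> in M.
           continuously_differentiable_at (\<lambda>(\<theta>, t). l (\<xi> \<theta> \<omega> - t)) (\<theta>, t)"
    and "\<exists>L\<in>borel_measurable M. integrable M (\<lambda>\<omega>. (L \<omega>)\<^sup>2) \<and>
           (\<forall>\<theta>\<in>\<Theta>. \<forall>t\<in>T. AE \<omega> in M. \<bar>l (\<xi> \<theta> \<omega> - t)\<bar> \<le> ereal (L \<omega>))"
    and "\<exists>K\<in>borel_measurable M. integrable M (\<lambda>\<omega>. (K \<omega>)\<^sup>2) \<and>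
           (\<forall>\<theta>\<^sub>1\<in>\<Theta>. \<forall>t\<^sub>1\<in>T. \<forall>\<theta>\<^sub>2\<in>\<Theta>. \<forall>t\<^sub>2\<in>T. AE \<omega> in M.
              \<bar>l (\<xi> \<theta>\<^sub>1 \<omega> - t\<^sub>1) - l (\<xi> \<theta>\<^sub>2 \<omega> - t\<^sub>2)\<bar>
                \<le> ereal (K \<omega> * norm ((\<theta>\<^sub>1, t\<^sub>1) - (\<theta>\<^sub>2, t\<^sub>2))))"
  shows "\<forall>\<theta>\<in>\<Theta>.
           ((\<lambda>\<theta>. real_of_ereal (oce_risk M l T (\<xi> \<theta>))) has_real_derivative
              (\<integral>\<omega>. deriv (\<lambda>z. real_of_ereal (l z)) (\<xi> \<theta> \<omega> - tstar \<theta>) * \<xi>' \<theta> \<omega> \<partial>M))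
             (at \<theta> within \<Theta>) \<and>
           (\<theta> islimpt \<Theta> \<longrightarrow>
              integrable M (\<lambda>\<omega>. deriv (\<lambda>z. real_of_ereal (l z)) (\<xi> \<theta> \<omega> - tstar \<theta>) * \<xi>' \<theta> \<omega>))"
proof -
  interpret prob_space M by fact
  have u: "utility_function u" and l: "l = loss_of_utility u" by fact+
  obtain L where L: "L \<in> borel_measurable M" "integrable M (\<lambda>\<omega>. (L \<omega>)\<^sup>2)"
    "\<And>\<theta> t. \<theta> \<in> \<Theta> \<Longrightarrow> t \<in> T \<Longrightarrow> AE \<omega> in M. \<bar>l (\<xi> \<theta> \<omega> - t)\<bar> \<le> ereal (L \<omega>)"
    using assms(13) by blast
  obtain K where K: "K \<in> borel_measurable M" "integrable M (\<lambda>\<omega>. (K \<omega>)\<^sup>2)"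
    "\<And>\<theta>\<^sub>1 t\<^sub>1 \<theta>\<^sub>2 t\<^sub>2. \<theta>\<^sub>1 \<in> \<Theta> \<Longrightarrow> t\<^sub>1 \<in> T \<Longrightarrow> \<theta>\<^sub>2 \<in> \<Theta> \<Longrightarrow> t\<^sub>2 \<in> T \<Longrightarrow> AE \<omega> in M.
      \<bar>l (\<xi> \<theta>\<^sub>1 \<omega> - t\<^sub>1) - l (\<xi> \<theta>\<^sub>2 \<omega> - t\<^sub>2)\<bar> \<le> ereal (K \<omega> * norm ((\<theta>\<^sub>1, t\<^sub>1) - (\<theta>\<^sub>2, t\<^sub>2)))"
    using assms(14) by blast
  have intL: "integrable M L" and intK: "integrable M K"
    using L(1,2) K(1,2) by (auto intro: square_integrable_imp_integrable)
  define f where "f = (\<lambda>z. real_of_ereal (l z))"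
  have f_meas[measurable]: "f \<in> borel_measurable borel"
    using borel_measurable_loss[OF u] unfolding f_def l by measurable
  have f'_meas[measurable]: "deriv f \<in> borel_measurable borel"
    using borel_measurable_deriv_loss[OF u] by (simp add: f_def l)
  have \<xi>_meas: "\<xi> \<theta> \<in> borel_measurable M" if "\<theta> \<in> \<Theta>" for \<theta>
    using assms(7) that by blast
  have fin: "AE \<omega> in M. l (\<xi> \<theta> \<omega> - t) = ereal (f (\<xi> \<theta> \<omega> - t)) \<and> \<bar>f (\<xi> \<theta> \<omega> - t)\<bar> \<le> L \<omega>"
    if "\<theta> \<in> \<Theta>" "t \<in> T" for \<theta> t
    using L(3)[OF that]
  proof eventually_elim
    case (elim \<omega>)
    then show ?case by (cases "l (\<xi> \<theta> \<omega> - t)") (auto simp: f_def)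
  qed
  have int: "integrable M (\<lambda>\<omega>. f (\<xi> \<theta> \<omega> - t))" if "\<theta> \<in> \<Theta>" "t \<in> T" for \<theta> t
  proof (rule Bochner_Integration.integrable_bound[OF intL])
    show "(\<lambda>\<omega>. f (\<xi> \<theta> \<omega> - t)) \<in> borel_measurable M"
      using \<xi>_meas[OF that(1)] by measurable
    show "AE \<omega> in M. norm (f (\<xi> \<theta> \<omega> - t)) \<le> norm (L \<omega>)"
      using fin[OF that] by eventually_elim auto
  qed
  \<comment> \<open>By the bound \<open>L\<close> the extended-real problem is the minimization of a real function.\<close>
  define \<phi> where "\<phi> \<theta> t = t + (\<integral>\<omega>. f (\<xi> \<theta> \<omega> - t) \<partial>M)" for \<theta> t
  have obj: "oce_objective M l (\<xi> \<theta>) t = ereal (\<phi> \<theta> t)" if "\<theta> \<in> \<Theta>" "t \<in> T" for \<theta> t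
  proof -
    have "AE \<omega> in M. l (\<xi> \<theta> \<omega> - t) = ereal (f (\<xi> \<theta> \<omega> - t))"
      using fin[OF that] by eventually_elim simp
    from ereal_expectation_eq_integral[OF this int[OF that]] show ?thesis
      by (simp add: oce_objective_def \<phi>_def)
  qed
  have argmin: "is_arg_min (oce_objective M l (\<xi> \<theta>)) (\<lambda>t. t \<in> T) t \<longleftrightarrow> t = tstar \<theta>"
    if "\<theta> \<in> \<Theta>" for \<theta> t
    using assms(10) that by blast
  have mT: "tstar \<theta> \<in> T" if "\<theta> \<in> \<Theta>" for \<theta>
    using argmin[OF that, of "tstar \<theta>"] by (simp add: is_arg_min_def)
  have min: "\<phi> \<theta> (tstar \<theta>) \<le> \<phi> \<theta> t" if "\<theta> \<in> \<Theta>" "t \<in> T" for \<theta> t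
    using argmin[OF that(1), of "tstar \<theta>"] that mT[OF that(1)]
    by (auto simp: is_arg_min_def obj not_less)
  have unique: "t = tstar \<theta>" if "\<theta> \<in> \<Theta>" "t \<in> T" "\<phi> \<theta> t \<le> \<phi> \<theta> (tstar \<theta>)" for \<theta> t
  proof -
    have "is_arg_min (oce_objective M l (\<xi> \<theta>)) (\<lambda>t. t \<in> T) t"
      unfolding is_arg_min_def using that min[OF that(1)] by (force simp: obj not_less)
    then show ?thesis using argmin[OF that(1)] by blast
  qed
  have risk: "oce_risk M l T (\<xi> \<theta>) = ereal (\<phi> \<theta> (tstar \<theta>))" if "\<theta> \<in> \<Theta>" for \<theta>
    unfolding oce_risk_def
  proof (rule antisym)
    show "(INF t\<in>T. oce_objective M l (\<xi> \<theta>) t) \<le> ereal (\<phi> \<theta> (tstar \<theta>))"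
      using INF_lower[OF mT[OF that], of "oce_objective M l (\<xi> \<theta>)"] obj[OF that mT[OF that]] by simp
    show "ereal (\<phi> \<theta> (tstar \<theta>)) \<le> (INF t\<in>T. oce_objective M l (\<xi> \<theta>) t)"
      using min[OF that] by (auto intro!: INF_greatest simp: obj[OF that])
  qed
  have lip: "AE \<omega> in M. \<bar>f (\<xi> \<theta>\<^sub>1 \<omega> - t\<^sub>1) - f (\<xi> \<theta>\<^sub>2 \<omega> - t\<^sub>2)\<bar>
      \<le> K \<omega> * norm ((\<theta>\<^sub>1, t\<^sub>1) - (\<theta>\<^sub>2, t\<^sub>2))"
    if "\<theta>\<^sub>1 \<in> \<Theta>" "t\<^sub>1 \<in> T" "\<theta>\<^sub>2 \<in> \<Theta>" "t\<^sub>2 \<in> T" for \<theta>\<^sub>1 t\<^sub>1 \<theta>\<^sub>2 t\<^sub>2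
    using K(3)[OF that] fin[OF that(1,2)] fin[OF that(3,4)] by eventually_elim simp
  have "(1 + \<bar>\<integral>\<omega>. K \<omega> \<partial>M\<bar>)-lipschitz_on (\<Theta> \<times> T) (\<lambda>(\<theta>, t). \<phi> \<theta> t)"
  proof (rule lipschitz_onI, clarify)
    fix \<theta>\<^sub>1 t\<^sub>1 \<theta>\<^sub>2 t\<^sub>2 assume in\<Theta>T: "\<theta>\<^sub>1 \<in> \<Theta>" "t\<^sub>1 \<in> T" "\<theta>\<^sub>2 \<in> \<Theta>" "t\<^sub>2 \<in> T"
    let ?d = "norm ((\<theta>\<^sub>1, t\<^sub>1) - (\<theta>\<^sub>2, t\<^sub>2))"
    let ?g = "\<lambda>\<omega>. f (\<xi> \<theta>\<^sub>1 \<omega> - t\<^sub>1) - f (\<xi> \<theta>\<^sub>2 \<omega> - t\<^sub>2)"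
    have g: "integrable M ?g"
      using int in\<Theta>T by auto
    have "\<bar>\<integral>\<omega>. ?g \<omega> \<partial>M\<bar> \<le> (\<integral>\<omega>. \<bar>?g \<omega>\<bar> \<partial>M)"
      using integral_norm_bound[of M ?g] by simp
    also have "\<dots> \<le> (\<integral>\<omega>. K \<omega> * ?d \<partial>M)"
      using lip[OF in\<Theta>T] g intK by (intro integral_mono_AE integrable_abs) auto
    also have "\<dots> \<le> \<bar>\<integral>\<omega>. K \<omega> \<partial>M\<bar> * ?d"
      by (simp add: mult_right_mono)
    finally have "\<bar>\<integral>\<omega>. ?g \<omega> \<partial>M\<bar> \<le> \<bar>\<integral>\<omega>. K \<omega> \<partial>M\<bar> * ?d" .
    moreover have "\<phi> \<theta>\<^sub>1 t\<^sub>1 - \<phi> \<theta>\<^sub>2 t\<^sub>2 = (t\<^sub>1 - t\<^sub>2) + (\<integral>\<omega>. ?g \<omega> \<partial>M)"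
      using int in\<Theta>T by (simp add: \<phi>_def)
    moreover have "\<bar>t\<^sub>1 - t\<^sub>2\<bar> \<le> ?d"
      using norm_snd_le[of "t\<^sub>1 - t\<^sub>2" "\<theta>\<^sub>1 - \<theta>\<^sub>2"] by simp
    ultimately have "\<bar>\<phi> \<theta>\<^sub>1 t\<^sub>1 - \<phi> \<theta>\<^sub>2 t\<^sub>2\<bar> \<le> ?d + \<bar>\<integral>\<omega>. K \<omega> \<partial>M\<bar> * ?d"
      by linarith
    then show "dist (\<phi> \<theta>\<^sub>1 t\<^sub>1) (\<phi> \<theta>\<^sub>2 t\<^sub>2) \<le> (1 + \<bar>\<integral>\<omega>. K \<omega> \<partial>M\<bar>) * dist (\<theta>\<^sub>1, t\<^sub>1) (\<theta>\<^sub>2, t\<^sub>2)"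
      by (simp add: dist_norm distrib_right)
  qed simp
  then have cont: "continuous_on \<Theta> tstar"
    using assms(4,5) mT min unique
    by (intro continuous_on_argmin[of \<Theta> T \<phi>] lipschitz_on_continuous_on) auto
  show ?thesis
  proof
    fix \<theta> assume \<theta>: "\<theta> \<in> \<Theta>"
    define G where "G \<omega> = deriv f (\<xi> \<theta> \<omega> - tstar \<theta>) * \<xi>' \<theta> \<omega>" for \<omega>
    have G_meas: "G \<in> borel_measurable M"
      using \<xi>_meas[OF \<theta>] bspec[OF assms(8) \<theta>] unfolding G_def by measurable
    have quot: "integrable M G \<and>
        (\<lambda>n. (\<phi> (s n) (\<tau> n) - \<phi> \<theta> (\<tau> n)) / (s n - \<theta>)) \<longlonglongrightarrow> (\<integral>\<omega>. G \<omega> \<partial>M)"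
      if s: "\<And>n. s n \<in> \<Theta> - {\<theta>}" "s \<longlonglongrightarrow> \<theta>" and \<tau>: "\<And>n. \<tau> n \<in> T" "\<tau> \<longlonglongrightarrow> tstar \<theta>" for s \<tau>
    proof -
      define q where "q n \<omega> = (f (\<xi> (s n) \<omega> - \<tau> n) - f (\<xi> \<theta> \<omega> - \<tau> n)) / (s n - \<theta>)" for n \<omega>
      have sn: "s n \<in> \<Theta>" "s n \<noteq> \<theta>" for n using s(1) by auto
      have q_meas: "q n \<in> borel_measurable M" for n
        using \<xi>_meas[OF \<theta>] \<xi>_meas[OF sn(1)[of n]] unfolding q_def by measurable
      have q_lim: "AE \<omega> in M. (\<lambda>n. q n \<omega>) \<longlonglongrightarrow> G \<omega>"
      proof -
        have "AE \<omega> in M. continuously_differentiable_at (\<lambda>(\<theta>, t). l (\<xi> \<theta> \<omega> - t)) (\<theta>, tstar \<theta>)"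
          using assms(12) \<theta> mT by blast
        moreover have "AE \<omega> in M. ((\<lambda>\<theta>. \<xi> \<theta> \<omega>) has_real_derivative \<xi>' \<theta> \<omega>) (at \<theta>)"
          using assms(9) \<theta> by blast
        ultimately show ?thesis
        proof eventually_elim
          case (elim \<omega>)
          from loss_difference_quotient_tendsto[OF elim s(2) sn(2) \<tau>(2)]
          show ?case unfolding q_def G_def f_def .
        qed
      qed
      have q_bound: "AE \<omega> in M. norm (q n \<omega>) \<le> K \<omega>" for n
        using lip[OF sn(1)[of n] \<tau>(1)[of n] \<theta> \<tau>(1)[of n]]
      proof eventually_elim
        case (elim \<omega>)
        then show ?case
          using sn(2)[of n] by (simp add: q_def norm_Pair divide_le_eq)
      qed
      have "(\<integral>\<omega>. q n \<omega> \<partial>M) = (\<phi> (s n) (\<tau> n) - \<phi> \<theta> (\<tau> n)) / (s n - \<theta>)" for n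
        using int[OF sn(1)[of n] \<tau>(1)[of n]] int[OF \<theta> \<tau>(1)[of n]] by (simp add: q_def \<phi>_def)
      then show ?thesis
        using integrable_dominated_convergence[OF G_meas q_meas intK q_lim q_bound]
          integral_dominated_convergence[OF G_meas q_meas intK q_lim q_bound] by simp
    qed
    have "((\<lambda>\<theta>. \<phi> \<theta> (tstar \<theta>)) has_real_derivative (\<integral>\<omega>. G \<omega> \<partial>M)) (at \<theta> within \<Theta>)"
      using quot by (intro envelope_derivative[where T = T and \<phi> = \<phi>] cont \<theta> mT min) auto
    then have "((\<lambda>\<theta>. real_of_ereal (oce_risk M l T (\<xi> \<theta>))) has_real_derivative (\<integral>\<omega>. G \<omega> \<partial>M))
        (at \<theta> within \<Theta>)"
      by (rule has_field_derivative_transform_within[OF _ zero_less_one \<theta>]) (simp add: risk)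
    moreover have "integrable M G" if limpt: "\<theta> islimpt \<Theta>"
    proof -
      obtain s where "\<And>n. s n \<in> \<Theta> - {\<theta>}" "s \<longlonglongrightarrow> \<theta>"
        using limpt unfolding islimpt_sequential by blast
      then show ?thesis
        using quot[of s "\<lambda>_. tstar \<theta>"] mT[OF \<theta>] by auto
    qed
    ultimately show "((\<lambda>\<theta>. real_of_ereal (oce_risk M l T (\<xi> \<theta>))) has_real_derivative
        (\<integral>\<omega>. deriv (\<lambda>z. real_of_ereal (l z)) (\<xi> \<theta> \<omega> - tstar \<theta>) * \<xi>' \<theta> \<omega> \<partial>M)) (at \<theta> within \<Theta>) \<and>
      (\<theta> islimpt \<Theta> \<longrightarrow>
        integrable M (\<lambda>\<omega>. deriv (\<lambda>z. real_of_ereal (l z)) (\<xi> \<theta> \<omega> - tstar \<theta>) * \<xi>' \<theta> \<omega>))"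
      unfolding G_def[abs_def] f_def by blast
  qed
qed

end
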